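(* Let $V,U\ge 0$ be independent random variables, not depending on $\alpha$, with $\mathbb{E}[V]=\mathbb{E}[U]=1$, variances $\sigma_V^2,\sigma_U^2$ satisfying $0<\sigma_V^2+\sigma_U^2<\infty$, and such that for some $\delta>0$ the functions $z\mapsto \mathbb{E}[e^{zV}]$ and $z\mapsto\mathbb{E}[e^{zU}]$ are analytic in an open strip containing $-\delta\le \mathrm{Re}(z)\le\delta$. For $\alpha\in(0,1)$ put $\rho=1-\alpha$, let $W=W_\alpha$ be the steady-state waiting time associated with $V$ and $\frac1\rho U$, and let $$\sigma_\alpha^2=(\sigma_V^2+\rho^{-2}\sigma_U^2)\,\rho .$$ Then $$\mathbb{E}\big[e^{-\alpha sW}\big]=\big(1+\sigma_\alpha^2 s/2\big)^{-1}+O\big(\alpha\log(1/\alpha)\big),\qquad \alpha\downarrow 0,$$ uniformly in any bounded set of complex $s$ with $\mathrm{Re}(s)\ge -1/(2\sigma_\alpha^2)$. That is, for every bounded $S\subset\mathbb{C}$ there are constants $K<\infty$ and $\alpha_0\in(0,1)$ such that for all $\alpha\in(0,\alpha_0)$ and all $s\in S$ with $\mathrm{Re}(s)\ge -1/(2\sigma_\alpha^2)$ the expectation on the left exists and the difference of the two transforms is at most $K\alpha\log(1/\alpha)$ in modulus.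
   Context: Steady-state waiting time (GI/G/1 queue): $W\ge 0$ is the (finite) random variable whose distribution is the stationary solution of $W\stackrel{d}{=}\big(W+V-\frac1\rho U\big)^+$, where $x^+=\max\{0,x\}$ and on the right-hand side $W,V,U$ are independent; here $\rho\in(0,1)$. *)

theory Defs
  imports "HOL-Probability.Probability" "HOL-Complex_Analysis.Complex_Analysis"
begin

text \<open>
  Integrability is stated separately because the Bochner integral of a non-integrable function
  is \<open>0\<close>: the transform must exist at every point of the strip.
\<close>

definition mgf_analytic_on_strip :: "'a measure \<Rightarrow> ('a \<Rightarrow> real) \<Rightarrow> real \<Rightarrow> bool" where
  "mgf_analytic_on_strip M X \<delta> \<longleftrightarrow>
     (\<exists>a b. a < - \<delta> \<and> \<delta> < b \<and>
        (\<forall>z. a < Re z \<and> Re z < b \<longrightarrow> integrable M (\<lambda>x. exp (z * complex_of_real (X x)))) \<and>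
        (\<lambda>z. \<integral>x. exp (z * complex_of_real (X x)) \<partial>M) analytic_on {z. a < Re z \<and> Re z < b})"

text \<open>
  \<open>W\<close>, a real-valued (hence finite) random variable on \<open>N\<close>, is a steady-state waiting time for
  the service time \<open>V\<close> and the interarrival time \<open>T\<close> on \<open>M\<close>: its law is that of
  \<open>(W + V - T)\<^sup>+\<close>, where the product of the three marginal laws makes the variables on the
  right-hand side independent.  \<open>W\<close> need not live on the same space as \<open>V\<close> and \<open>T\<close>.
\<close>

definition steady_state_waiting_time ::
  "'b measure \<Rightarrow> ('b \<Rightarrow> real) \<Rightarrow> 'a measure \<Rightarrow> ('a \<Rightarrow> real) \<Rightarrow> ('a \<Rightarrow> real) \<Rightarrow> bool" where
  "steady_state_waiting_time N W M V T \<longleftrightarrow>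
     prob_space N \<and> W \<in> borel_measurable N \<and> (AE y in N. 0 \<le> W y) \<and>
     distr N borel W =
       distr (distr N borel W \<Otimes>\<^sub>M (distr M borel V \<Otimes>\<^sub>M distr M borel T)) borel
         (\<lambda>(w, v, t). max 0 (w + v - t))"

definition heavy_traffic_variance ::
  "'a measure \<Rightarrow> ('a \<Rightarrow> real) \<Rightarrow> ('a \<Rightarrow> real) \<Rightarrow> real \<Rightarrow> real" where
  "heavy_traffic_variance M V U \<alpha> =
     (let \<rho> = 1 - \<alpha> in
       (prob_space.variance M V + prob_space.variance M U / \<rho>\<^sup>2) * \<rho>)"

end

theory Submission
  imports Defs
begin

text \<open>
  Write \<open>X = V - U / \<rho>\<close>, \<open>f z = E (exp (- z W))\<close>, \<open>\<phi> z = E (exp (- z X))\<close> and let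
  \<open>I = (W + X)\<^sup>-\<close>.  Stationarity of \<open>W\<close> gives
  \<open>f z (1 - \<phi> z) = E (1 - exp (z I))\<close> and \<open>E I = - E X = \<alpha> / \<rho>\<close>.  At \<open>z = \<alpha> s\<close>, divide by
  \<open>- z \<alpha> / \<rho>\<close>: a second-order expansion of \<open>\<phi>\<close> turns the left-hand side into
  \<open>f z (1 + \<sigma>\<^sup>2 s / 2 + O(\<alpha>))\<close>, and a first-order expansion turns the right-hand side into
  \<open>1 + O(E I\<^sup>2)\<close>.  Since \<open>I\<close> is dominated by \<open>U / \<rho>\<close>, which has exponential tails, truncation at a
  multiple of \<open>log (1 / \<alpha>)\<close> gives \<open>E I\<^sup>2 = O(E I log (1 / \<alpha>)) = O(\<alpha> log (1 / \<alpha>))\<close>.  That \<open>f z\<close> exists to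
  the left of the imaginary axis follows from the drift bound
  \<open>E (exp (\<theta> X)) < 1 \<Longrightarrow> E (exp (\<theta> W)) < \<infinity>\<close> with \<open>\<theta> = \<alpha> / (2 \<sigma>\<^sup>2)\<close>.
\<close>

section \<open>Stationary waiting times\<close>

lemma (in pair_sigma_finite)
  fixes f :: "'a \<Rightarrow> 'c :: {real_normed_field, banach, second_countable_topology}"
  assumes [measurable]: "integrable M1 f" "integrable M2 g"
  shows integrable_times: "integrable (M1 \<Otimes>\<^sub>M M2) (\<lambda>(x, y). f x * g y)"
    and integral_times: "(\<integral>(x, y). f x * g y \<partial>(M1 \<Otimes>\<^sub>M M2)) = integral\<^sup>L M1 f * integral\<^sup>L M2 g"
proof -
  have f: "integrable M1 f" and g: "integrable M2 g" by fact+
  show i: "integrable (M1 \<Otimes>\<^sub>M M2) (\<lambda>(x, y). f x * g y)"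
  proof (rule Fubini_integrable)
    show "integrable M1 (\<lambda>x. \<integral>y. norm (case (x, y) of (x, y) \<Rightarrow> f x * g y) \<partial>M2)"
      using f by (simp add: norm_mult)
  qed (use g in auto)
  show "(\<integral>(x, y). f x * g y \<partial>(M1 \<Otimes>\<^sub>M M2)) = integral\<^sup>L M1 f * integral\<^sup>L M2 g"
    using integral_fst'[OF i] by simp
qed

text \<open>Service and interarrival time enter only through their difference \<open>X\<close>.
  Stating the fixed point on the product of \<open>N\<close> and \<open>M\<close> builds in the
  independence of \<open>W\<close> and \<open>X\<close> and makes Fubini's theorem directly
  applicable.\<close>

locale lindley_stationary = N: prob_space N + M: prob_space M
  for N :: "'b measure" and M :: "'a measure" +
  fixes W :: "'b \<Rightarrow> real" and X :: "'a \<Rightarrow> real"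
  assumes W_meas [measurable]: "W \<in> borel_measurable N"
    and X_meas [measurable]: "X \<in> borel_measurable M"
    and W_nonneg: "AE y in N. 0 \<le> W y"
    and stationary: "distr N borel W = distr (N \<Otimes>\<^sub>M M) borel (\<lambda>(y, x). max 0 (W y + X x))"
begin

sublocale NM: pair_prob_space N M ..

lemma integral_stationary:
  fixes g :: "real \<Rightarrow> 'c :: {banach, second_countable_topology}"
  assumes [measurable]: "g \<in> borel_measurable borel"
  shows "(\<integral>y. g (W y) \<partial>N) = (\<integral>(y, x). g (max 0 (W y + X x)) \<partial>(N \<Otimes>\<^sub>M M))"
proof -
  have "(\<integral>y. g (W y) \<partial>N) = integral\<^sup>L (distr N borel W) g"
    by (simp add: integral_distr)
  also have "\<dots> = (\<integral>(y, x). g (max 0 (W y + X x)) \<partial>(N \<Otimes>\<^sub>M M))"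
    unfolding stationary by (subst integral_distr) (auto simp: case_prod_unfold)
  finally show ?thesis .
qed

lemma integrable_stationary_iff:
  fixes g :: "real \<Rightarrow> 'c :: {banach, second_countable_topology}"
  assumes [measurable]: "g \<in> borel_measurable borel"
  shows "integrable N (\<lambda>y. g (W y)) \<longleftrightarrow>
    integrable (N \<Otimes>\<^sub>M M) (\<lambda>(y, x). g (max 0 (W y + X x)))"
proof -
  have "integrable N (\<lambda>y. g (W y)) \<longleftrightarrow> integrable (distr N borel W) g"
    by (simp add: integrable_distr_eq)
  also have "\<dots> \<longleftrightarrow> integrable (N \<Otimes>\<^sub>M M) (\<lambda>(y, x). g (max 0 (W y + X x)))"
    unfolding stationary by (subst integrable_distr_eq) (auto simp: case_prod_unfold)
  finally show ?thesis .
qed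

text \<open>Without prior integrability of \<open>exp (\<theta> * W)\<close> the stationary law can only be tested on
  bounded functions; taking the minimum with \<open>K\<close> preserves the drift inequality because
  \<open>min \<cdot> K\<close> is concave and increasing.\<close>

lemma truncated_drift:
  assumes \<theta>: "0 \<le> \<theta>" and eX: "integrable M (\<lambda>x. exp (\<theta> * X x))" and K: "0 \<le> K"
  defines "l \<equiv> \<integral>x. exp (\<theta> * X x) \<partial>M"
  shows "(\<integral>y. min (exp (\<theta> * W y)) K \<partial>N) \<le> (\<integral>y. min (l * exp (\<theta> * W y) + 1) K \<partial>N)"
proof -
  have l0: "0 \<le> l" unfolding l_def by simp
  have bnd: "integrable (N \<Otimes>\<^sub>M M) (\<lambda>(y, x). min (exp (\<theta> * max 0 (W y + X x))) K)"
    by (rule NM.P.integrable_const_bound[of _ K]) (use K in \<open>auto simp: min_def\<close>)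
  have "(\<integral>y. min (exp (\<theta> * W y)) K \<partial>N)
      = (\<integral>(y, x). min (exp (\<theta> * max 0 (W y + X x))) K \<partial>(N \<Otimes>\<^sub>M M))"
    by (rule integral_stationary[of "\<lambda>w. min (exp (\<theta> * w)) K"]) simp
  also have "\<dots> = (\<integral>y. (\<integral>x. min (exp (\<theta> * max 0 (W y + X x))) K \<partial>M) \<partial>N)"
    using NM.integral_fst'[OF bnd] by simp
  also have "\<dots> \<le> (\<integral>y. min (l * exp (\<theta> * W y) + 1) K \<partial>N)"
  proof (rule integral_mono)
    show "integrable N (\<lambda>y. \<integral>x. min (exp (\<theta> * max 0 (W y + X x))) K \<partial>M)"
      using NM.integrable_fst'[OF bnd] by simp
    show "integrable N (\<lambda>y. min (l * exp (\<theta> * W y) + 1) K)"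
      by (rule N.integrable_const_bound[of _ K]) (use K l0 in \<open>auto simp: min_def\<close>)
    fix y
    have iM: "integrable M (\<lambda>x. min (exp (\<theta> * max 0 (W y + X x))) K)"
      by (rule M.integrable_const_bound[of _ K]) (use K in \<open>auto simp: min_def\<close>)
    have "(\<integral>x. min (exp (\<theta> * max 0 (W y + X x))) K \<partial>M)
        \<le> (\<integral>x. exp (\<theta> * W y) * exp (\<theta> * X x) + 1 \<partial>M)"
    proof (intro integral_mono iM)
      fix x
      \<comment> \<open>The left-hand side is one of the two summands on the right, according to the
        sign of \<open>W y + X x\<close>.\<close>
      have "exp (\<theta> * max 0 (W y + X x)) \<le> exp (\<theta> * W y) * exp (\<theta> * X x) + 1"
        by (auto simp: max_def algebra_simps simp flip: exp_add)
      then show "min (exp (\<theta> * max 0 (W y + X x))) K \<le> exp (\<theta> * W y) * exp (\<theta> * X x) + 1"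
        by simp
    qed (use eX in auto)
    also have "\<dots> = l * exp (\<theta> * W y) + 1"
      using eX by (simp add: l_def M.prob_space)
    finally have 1: "(\<integral>x. min (exp (\<theta> * max 0 (W y + X x))) K \<partial>M) \<le> l * exp (\<theta> * W y) + 1" .
    \<comment> \<open>The trivial bound by \<open>K\<close>, combined with the bound just obtained,
      plays the role of Jensen's inequality for truncation at \<open>K\<close>.\<close>
    have "(\<integral>x. min (exp (\<theta> * max 0 (W y + X x))) K \<partial>M) \<le> (\<integral>x. K \<partial>M)"
      by (intro integral_mono iM) auto
    with 1 show "(\<integral>x. min (exp (\<theta> * max 0 (W y + X x))) K \<partial>M) \<le> min (l * exp (\<theta> * W y) + 1) K"
      by (simp add: M.prob_space)
  qed
  finally show ?thesis .
qed

text \<open>With \<open>h = exp (\<theta> * W)\<close>, the truncated drift inequality bounds the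
  mean of \<open>h\<close> on the event \<open>h < K\<close> by \<open>1 / (1 - l)\<close>,
  uniformly in \<open>K\<close>. Monotone convergence then removes the truncation.\<close>

lemma integrable_exp_W:
  assumes \<theta>: "0 \<le> \<theta>" and eX: "integrable M (\<lambda>x. exp (\<theta> * X x))"
    and less: "(\<integral>x. exp (\<theta> * X x) \<partial>M) < 1"
  shows "integrable N (\<lambda>y. exp (\<theta> * W y))"
proof -
  define l where "l = (\<integral>x. exp (\<theta> * X x) \<partial>M)"
  have l: "0 \<le> l" "l < 1" using less by (auto simp: l_def)
  define h where "h y = exp (\<theta> * W y)" for y
  have [measurable]: "h \<in> borel_measurable N" unfolding h_def by measurable
  have h0: "0 < h y" for y by (simp add: h_def)
  have bd: "(\<integral>y. h y * indicator {y. h y < K} y \<partial>N) \<le> 1 / (1 - l)"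
      and bi: "integrable N (\<lambda>y. h y * indicator {y. h y < K} y)"
    if K: "1 / (1 - l) \<le> K" for K
  proof -
    have K0: "0 < K" using K l by (smt (verit) divide_pos_pos)
    show bi: "integrable N (\<lambda>y. h y * indicator {y. h y < K} y)"
      by (rule N.integrable_const_bound[of _ K])
        (use K0 h0 in \<open>auto simp: indicator_def abs_of_pos\<close>)
    have i1: "integrable N (\<lambda>y. min (h y) K)"
      by (rule N.integrable_const_bound[of _ K]) (use K0 h0 in \<open>auto simp: min_def abs_of_pos\<close>)
    have i2: "integrable N (\<lambda>y. min (l * h y + 1) K)"
    proof (rule N.integrable_const_bound[of _ K])
      have "0 \<le> l * h y" for y using l h0[of y] by simp
      then show "AE y in N. norm (min (l * h y + 1) K) \<le> K"
        using K0 by (auto simp: min_def abs_if not_less intro!: AE_I2) (smt (verit))+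
    qed simp
    \<comment> \<open>Where \<open>h y < K\<close>, the right integrand is at least
      \<open>h y - (l * h y + 1)\<close>. Elsewhere the first minimum equals \<open>K\<close>, so
      the difference is nonnegative.\<close>
    have "(\<integral>y. (1 - l) * (h y * indicator {y. h y < K} y) - 1 \<partial>N)
        \<le> (\<integral>y. min (h y) K - min (l * h y + 1) K \<partial>N)"
    proof (rule integral_mono)
      show "integrable N (\<lambda>y. (1 - l) * (h y * indicator {y. h y < K} y) - 1)"
        using bi by auto
      fix y
      show "(1 - l) * (h y * indicator {y. h y < K} y) - 1 \<le> min (h y) K - min (l * h y + 1) K"
        by (auto simp: indicator_def algebra_simps min_def)
    qed (use i1 i2 in auto)
    also have "\<dots> \<le> 0"
      using truncated_drift[OF \<theta> eX, of K] K0 i1 i2 by (simp add: h_def l_def)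
    finally have "(1 - l) * (\<integral>y. h y * indicator {y. h y < K} y \<partial>N) \<le> 1"
      using bi by (simp add: N.prob_space)
    then show "(\<integral>y. h y * indicator {y. h y < K} y \<partial>N) \<le> 1 / (1 - l)"
      using l by (simp add: field_simps)
  qed
  define k where "k n = 1 / (1 - l) + real n" for n
  define F where "F n y = h y * indicator {y. h y < k n} y" for n y
  have kl: "1 / (1 - l) \<le> k n" for n by (simp add: k_def)
  have Fint: "integrable N (F n)" and Fle: "integral\<^sup>L N (F n) \<le> 1 / (1 - l)" for n
    using bi[OF kl] bd[OF kl] by (simp_all add: F_def [abs_def])
  have mono: "mono (\<lambda>n. F n y)" for y
    using h0[of y] by (intro monoI) (auto simp: F_def indicator_def k_def)
  have conv: "(\<lambda>n. F n y) \<longlonglongrightarrow> h y" for y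
  proof (rule tendsto_eventually)
    obtain n0 where "h y < real n0" using reals_Archimedean2 by blast
    then have "F n y = h y" if "n \<ge> n0" for n
      using that l by (auto simp: F_def k_def indicator_def not_less)
        (smt (verit) divide_pos_pos of_nat_mono)
    then show "\<forall>\<^sub>F n in sequentially. F n y = h y"
      by (auto simp: eventually_sequentially)
  qed
  have inc: "incseq (\<lambda>n. integral\<^sup>L N (F n))"
    by (intro monoI integral_mono Fint) (use mono in \<open>auto simp: mono_def\<close>)
  then obtain L where L: "(\<lambda>n. integral\<^sup>L N (F n)) \<longlonglongrightarrow> L"
    using incseq_convergent[OF inc, of "1 / (1 - l)"] Fle by metis
  have "integrable N h"
    by (rule integrable_monotone_convergence[OF Fint _ _ L]) (use mono conv in auto)
  then show ?thesis by (simp add: h_def [abs_def])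
qed

lemma Re_exp_bound_W:
  assumes "0 \<le> \<theta>" "- \<theta> \<le> Re z"
  shows "AE y in N. norm (exp (- z * complex_of_real (W y))) \<le> norm (exp (\<theta> * W y))"
  using W_nonneg
proof eventually_elim
  case (elim y)
  then have "(- Re z) * W y \<le> \<theta> * W y"
    using assms by (intro mult_right_mono) auto
  then show ?case by simp
qed

lemma integrable_cexp_W:
  assumes "0 \<le> \<theta>" "- \<theta> \<le> Re z" "integrable N (\<lambda>y. exp (\<theta> * W y))"
  shows "integrable N (\<lambda>y. exp (- z * complex_of_real (W y)))"
  by (rule Bochner_Integration.integrable_bound[OF assms(3)]) (use Re_exp_bound_W assms in auto)

section \<open>Idle time and the exact transform identity\<close>

definition idle :: "'b \<times> 'a \<Rightarrow> real" where
  "idle = (\<lambda>(y, x). max 0 (- (W y + X x)))"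

lemma idle_meas [measurable]: "idle \<in> borel_measurable (N \<Otimes>\<^sub>M M)"
  unfolding idle_def by measurable

text \<open>At least one of the positive part \<open>p\<close> and the negative part
  \<open>n\<close> of \<open>u = w + x\<close> vanishes. Hence
  \<open>exp (- z * p) + exp (z * n) = 1 + exp (- z * u)\<close>, and \<open>exp (- z * u)\<close>
  factors.\<close>

lemma cexp_idle:
  "exp (- z * complex_of_real (max 0 (w + x))) =
   exp (- z * complex_of_real w) * exp (- z * complex_of_real x)
     + (1 - exp (z * complex_of_real (max 0 (- (w + x)))))"
proof (cases "0 \<le> w + x")
  case True
  then have "max 0 (w + x) = w + x" "max 0 (- (w + x)) = 0" by auto
  then show ?thesis by (simp add: algebra_simps flip: exp_add)
next
  case False
  then have "max 0 (w + x) = 0" "max 0 (- (w + x)) = - (w + x)" by auto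
  then show ?thesis by (simp add: algebra_simps flip: exp_add)
qed

text \<open>Integrate \<open>cexp_idle\<close> over the product space: stationarity turns the
  reflected term back into the transform of \<open>W\<close>, and independence splits the
  unreflected term. Integrability of the idle term follows since it is a difference of integrable
  functions.\<close>

lemma waiting_idle_transform:
  assumes W: "integrable N (\<lambda>y. exp (- z * complex_of_real (W y)))"
    and X: "integrable M (\<lambda>x. exp (- z * complex_of_real (X x)))"
  shows "integrable (N \<Otimes>\<^sub>M M) (\<lambda>p. 1 - exp (z * complex_of_real (idle p)))"
    and "(\<integral>y. exp (- z * complex_of_real (W y)) \<partial>N)
           * (1 - (\<integral>x. exp (- z * complex_of_real (X x)) \<partial>M))
         = (\<integral>p. 1 - exp (z * complex_of_real (idle p)) \<partial>(N \<Otimes>\<^sub>M M))"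
proof -
  define f where "f = (\<lambda>(y, x). exp (- z * complex_of_real (max 0 (W y + X x))))"
  define g where "g = (\<lambda>(y, x). exp (- z * complex_of_real (W y)) * exp (- z * complex_of_real (X x)))"
  have f: "integrable (N \<Otimes>\<^sub>M M) f"
    unfolding f_def using W by (subst (asm) integrable_stationary_iff[of "\<lambda>w. exp (- z * complex_of_real w)"]) auto
  have g: "integrable (N \<Otimes>\<^sub>M M) g"
    unfolding g_def by (rule NM.integrable_times[OF W X])
  have eq: "1 - exp (z * complex_of_real (idle p)) = f p - g p" for p
    unfolding f_def g_def idle_def case_prod_unfold by (subst cexp_idle) simp
  show "integrable (N \<Otimes>\<^sub>M M) (\<lambda>p. 1 - exp (z * complex_of_real (idle p)))"
    unfolding eq using f g by auto
  have "integral\<^sup>L (N \<Otimes>\<^sub>M M) f = (\<integral>y. exp (- z * complex_of_real (W y)) \<partial>N)"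
    unfolding f_def by (rule integral_stationary[of "\<lambda>w. exp (- z * complex_of_real w)", symmetric]) simp
  moreover have "integral\<^sup>L (N \<Otimes>\<^sub>M M) g
      = (\<integral>y. exp (- z * complex_of_real (W y)) \<partial>N) * (\<integral>x. exp (- z * complex_of_real (X x)) \<partial>M)"
    unfolding g_def by (rule NM.integral_times[OF W X])
  ultimately show "(\<integral>y. exp (- z * complex_of_real (W y)) \<partial>N)
           * (1 - (\<integral>x. exp (- z * complex_of_real (X x)) \<partial>M))
         = (\<integral>p. 1 - exp (z * complex_of_real (idle p)) \<partial>(N \<Otimes>\<^sub>M M))"
    unfolding eq using f g by (simp add: algebra_simps)
qed

text \<open>Integrate \<open>idle = max 0 (W + X) - W - X\<close>. The first two terms have the same
  mean by stationarity and cancel, which is legitimate because \<open>W\<close> is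
  integrable.\<close>

lemma mean_idle:
  assumes W: "integrable N W" and X: "integrable M X"
  shows "integrable (N \<Otimes>\<^sub>M M) idle"
    and "(\<integral>p. idle p \<partial>(N \<Otimes>\<^sub>M M)) = - (\<integral>x. X x \<partial>M)"
proof -
  define f where "f = (\<lambda>(y, x). max 0 (W y + X x))"
  have f: "integrable (N \<Otimes>\<^sub>M M) f"
    unfolding f_def using W integrable_stationary_iff[of "\<lambda>w. w"] by auto
  have w: "integrable (N \<Otimes>\<^sub>M M) (\<lambda>(y, x). W y * 1)"
    by (rule NM.integrable_times[OF W]) simp
  have x: "integrable (N \<Otimes>\<^sub>M M) (\<lambda>(y, x). 1 * X x)"
    by (rule NM.integrable_times[OF _ X]) simp
  have eq: "idle p = f p - (case p of (y, x) \<Rightarrow> W y * 1) - (case p of (y, x) \<Rightarrow> 1 * X x)" for p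
    unfolding f_def idle_def by (auto simp: case_prod_unfold)
  show "integrable (N \<Otimes>\<^sub>M M) idle"
    using f w x by (subst eq [abs_def]) auto
  have "integral\<^sup>L (N \<Otimes>\<^sub>M M) f = (\<integral>y. W y \<partial>N)"
    unfolding f_def by (rule integral_stationary[of "\<lambda>w. w", symmetric]) simp
  moreover have "(\<integral>(y, x). W y * 1 \<partial>(N \<Otimes>\<^sub>M M)) = (\<integral>y. W y \<partial>N)"
    by (subst NM.integral_times[OF W]) (simp_all add: M.prob_space)
  moreover have "(\<integral>(y, x). 1 * X x \<partial>(N \<Otimes>\<^sub>M M)) = (\<integral>x. X x \<partial>M)"
    by (subst NM.integral_times[OF _ X]) (simp_all add: N.prob_space)
  ultimately show "(\<integral>p. idle p \<partial>(N \<Otimes>\<^sub>M M)) = - (\<integral>x. X x \<partial>M)"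
    unfolding eq using f w x by simp
qed

end

section \<open>Expansions of moment generating functions\<close>

text \<open>A single term of the exponential series. It lets an exponential moment absorb polynomial
  factors.\<close>

lemma power_le_exp:
  fixes x c :: real
  assumes "0 \<le> x" "0 < c"
  shows "x ^ n \<le> fact n / c ^ n * exp (c * x)"
proof -
  have "(c * x) ^ n / fact n \<le> (\<Sum>k. (c * x) ^ k /\<^sub>R fact k)"
  proof -
    have "(\<Sum>k\<in>{n}. (c * x) ^ k /\<^sub>R fact k) \<le> (\<Sum>k. (c * x) ^ k /\<^sub>R fact k)"
      by (rule sum_le_suminf) (use assms summable_exp_generic[of "c * x"] in auto)
    then show ?thesis by (simp add: field_simps)
  qed
  also have "\<dots> = exp (c * x)" by (simp add: exp_def)
  finally show ?thesis using assms by (simp add: field_simps)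
qed

lemma norm_exp_Taylor1:
  fixes z :: "'a :: {real_normed_field, banach}"
  shows "norm (exp z - (1 + z)) \<le> norm z ^ 2 * exp (norm z)"
  using Taylor_exp_field[of z 1] by (simp add: mult.commute power2_eq_square)

lemma norm_exp_Taylor2:
  fixes z :: "'a :: {real_normed_field, banach}"
  shows "norm (exp z - (1 + z + z ^ 2 / 2)) \<le> norm z ^ 3 * exp (norm z)"
proof -
  have "norm (exp z - (1 + z + z ^ 2 / 2)) \<le> norm z ^ 3 * exp (norm z) / 2"
    using Taylor_exp_field[of z 2] by (simp add: mult.commute eval_nat_numeral)
  also have "\<dots> \<le> norm z ^ 3 * exp (norm z)" by simp
  finally show ?thesis .
qed

context prob_space
begin

text \<open>The bound \<open>R\<close> can be chosen once for a whole family of variables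
  \<open>X\<close>, so later constants depend only on \<open>c\<close> and the mean of
  \<open>exp (c * R)\<close>. The type of \<open>z\<close> is general because real exponents serve
  the drift condition and complex ones the transform.\<close>

lemma
  fixes X R :: "'a \<Rightarrow> real" and z :: "'c :: {real_normed_field, banach, second_countable_topology}"
  assumes [measurable]: "random_variable borel X"
    and dom: "AE x in M. \<bar>X x\<bar> \<le> R x"
    and c: "0 < c" and R: "integrable M (\<lambda>x. exp (c * R x))"
  shows integrable_power_exp_dominated: "integrable M (\<lambda>x. X x ^ n)"
    and integrable_exp_dominated:
      "norm z \<le> c \<Longrightarrow> integrable M (\<lambda>x. exp (z * of_real (X x)))"
proof -
  show "integrable M (\<lambda>x. X x ^ n)"
  proof (rule Bochner_Integration.integrable_bound)
    show "integrable M (\<lambda>x. fact n / c ^ n * exp (c * R x))" using R by simp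
    show "AE x in M. norm (X x ^ n) \<le> norm (fact n / c ^ n * exp (c * R x))"
      using dom
    proof eventually_elim
      case (elim x)
      have "norm (X x ^ n) \<le> fact n / c ^ n * exp (c * \<bar>X x\<bar>)"
        using power_le_exp[of "\<bar>X x\<bar>" c n] c by (simp add: power_abs)
      also have "\<dots> \<le> fact n / c ^ n * exp (c * R x)"
        using elim c by (intro mult_left_mono) auto
      finally show ?case using c by simp
    qed
  qed simp
  show "integrable M (\<lambda>x. exp (z * of_real (X x)))" if z: "norm z \<le> c"
  proof (rule Bochner_Integration.integrable_bound[OF R])
    show "AE x in M. norm (exp (z * of_real (X x))) \<le> norm (exp (c * R x))"
      using dom
    proof eventually_elim
      case (elim x)
      have "norm (exp (z * of_real (X x))) \<le> exp (norm (z * of_real (X x)))"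
        by (rule norm_exp)
      also have "\<dots> \<le> exp (c * R x)"
        using elim z c by (auto simp: norm_mult intro!: mult_mono)
      finally show ?case by simp
    qed
  qed measurable
qed

text \<open>Half of the exponent \<open>c\<close> pays for \<open>exp (norm z * R)\<close> and the
  other half for \<open>R ^ 3\<close>. The constant 48 is \<open>fact 3 * 2 ^ 3\<close>.\<close>

lemma mgf_Taylor2:
  fixes X R :: "'a \<Rightarrow> real" and z :: "'c :: {real_normed_field, banach, second_countable_topology}"
  assumes X [measurable]: "random_variable borel X"
    and dom: "AE x in M. \<bar>X x\<bar> \<le> R x"
    and c: "0 < c" and R: "integrable M (\<lambda>x. exp (c * R x))"
    and z: "norm z \<le> c / 2"
  shows "norm ((\<integral>x. exp (z * of_real (X x)) \<partial>M)
            - (1 + z * of_real (\<integral>x. X x \<partial>M) + z ^ 2 / 2 * of_real (\<integral>x. (X x) ^ 2 \<partial>M)))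
         \<le> norm z ^ 3 * (48 / c ^ 3 * (\<integral>x. exp (c * R x) \<partial>M))"
proof -
  have "norm z \<le> c" using z c by simp
  then have e: "integrable M (\<lambda>x. exp (z * of_real (X x)))"
    by (rule integrable_exp_dominated[OF X dom c R])
  have X1: "integrable M X" and X2: "integrable M (\<lambda>x. (X x)\<^sup>2)"
    using integrable_power_exp_dominated[OF X dom c R, of 1]
      integrable_power_exp_dominated[OF X dom c R, of 2] by simp_all
  define t where "t x = exp (z * of_real (X x))
      - (1 + z * of_real (X x) + z ^ 2 / 2 * of_real ((X x) ^ 2))" for x
  have t: "integrable M t"
    unfolding t_def using e X1 X2 by (simp del: of_real_power)
  have "(\<integral>x. exp (z * of_real (X x)) \<partial>M)
            - (1 + z * of_real (\<integral>x. X x \<partial>M) + z ^ 2 / 2 * of_real (\<integral>x. (X x) ^ 2 \<partial>M))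
      = (\<integral>x. t x \<partial>M)"
    unfolding t_def using e X1 X2 by (simp add: prob_space del: of_real_power)
  also have "norm \<dots> \<le> (\<integral>x. norm z ^ 3 * (48 / c ^ 3 * exp (c * R x)) \<partial>M)"
  proof (rule order_trans[OF integral_norm_bound], rule integral_mono_AE)
    show "integrable M (\<lambda>x. norm (t x))" using t by simp
    show "integrable M (\<lambda>x. norm z ^ 3 * (48 / c ^ 3 * exp (c * R x)))" using R by simp
    show "AE x in M. norm (t x) \<le> norm z ^ 3 * (48 / c ^ 3 * exp (c * R x))"
      using dom
    proof eventually_elim
      case (elim x)
      let ?w = "z * of_real (X x)"
      have R0: "0 \<le> R x" using elim by simp
      have w: "norm ?w \<le> norm z * R x" using elim by (auto simp: norm_mult intro!: mult_left_mono)
      have "norm (t x) = norm (exp ?w - (1 + ?w + ?w ^ 2 / 2))"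
        by (simp add: t_def power_mult_distrib)
      also have "\<dots> \<le> norm ?w ^ 3 * exp (norm ?w)" by (rule norm_exp_Taylor2)
      also have "\<dots> \<le> (norm z * R x) ^ 3 * exp (c / 2 * R x)"
      proof (intro mult_mono power_mono w)
        have "norm z * R x \<le> c / 2 * R x" using z R0 by (intro mult_right_mono) auto
        with w show "exp (norm ?w) \<le> exp (c / 2 * R x)" by simp
      qed (use R0 in auto)
      also have "\<dots> = norm z ^ 3 * (R x ^ 3 * exp (c / 2 * R x))"
        by (simp add: power_mult_distrib)
      also have "\<dots> \<le> norm z ^ 3 * ((fact 3 / (c / 2) ^ 3 * exp (c / 2 * R x)) * exp (c / 2 * R x))"
        using power_le_exp[OF R0, of "c / 2" 3] c
        by (intro mult_left_mono mult_right_mono) auto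
      also have "\<dots> = norm z ^ 3 * (48 / c ^ 3 * exp (c * R x))"
        by (simp add: eval_nat_numeral field_simps flip: exp_add)
      finally show ?case .
    qed
  qed
  finally show ?thesis using R by simp
qed

text \<open>The first-order remainder is split at level \<open>L\<close>: below \<open>L\<close> it is controlled by the mean
  of \<open>I\<close>, above \<open>L\<close> by the exponential tail.  The optimal \<open>L\<close> is logarithmic in the mean, which
  is where the logarithm in the error term comes from.\<close>

lemma mgf_Taylor1_split:
  fixes I R :: "'a \<Rightarrow> real" and z :: complex
  assumes I [measurable]: "random_variable borel I"
    and dom: "AE x in M. 0 \<le> I x \<and> I x \<le> R x"
    and c: "0 < c" and R: "integrable M (\<lambda>x. exp (c * R x))"
    and z: "norm z \<le> c / 4" and L: "0 \<le> L"
  shows "norm ((\<integral>x. exp (z * of_real (I x)) \<partial>M) - (1 + z * of_real (\<integral>x. I x \<partial>M)))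
         \<le> norm z ^ 2 * (L * exp (norm z * L) * (\<integral>x. I x \<partial>M)
               + 32 / c ^ 2 * exp (- (c / 2 * L)) * (\<integral>x. exp (c * R x) \<partial>M))"
proof -
  have dom': "AE x in M. \<bar>I x\<bar> \<le> R x" using dom by auto
  have "norm z \<le> c" using z c by simp
  then have e: "integrable M (\<lambda>x. exp (z * of_real (I x)))"
    by (rule integrable_exp_dominated[OF I dom' c R])
  have I1: "integrable M I"
    using integrable_power_exp_dominated[OF I dom' c R, of 1] by simp
  define t where "t x = exp (z * of_real (I x)) - (1 + z * of_real (I x))" for x
  have t: "integrable M t"
    unfolding t_def using e I1 by simp
  have "(\<integral>x. exp (z * of_real (I x)) \<partial>M) - (1 + z * of_real (\<integral>x. I x \<partial>M)) = (\<integral>x. t x \<partial>M)"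
    unfolding t_def using e I1 by (simp add: prob_space)
  also have "norm \<dots> \<le> (\<integral>x. norm z ^ 2 * (L * exp (norm z * L) * I x
               + 32 / c ^ 2 * exp (- (c / 2 * L)) * exp (c * R x)) \<partial>M)"
  proof (rule order_trans[OF integral_norm_bound], rule integral_mono_AE)
    show "integrable M (\<lambda>x. norm (t x))" using t by simp
    show "integrable M (\<lambda>x. norm z ^ 2 * (L * exp (norm z * L) * I x
               + 32 / c ^ 2 * exp (- (c / 2 * L)) * exp (c * R x)))"
      using R I1 by simp
    show "AE x in M. norm (t x) \<le> norm z ^ 2 * (L * exp (norm z * L) * I x
               + 32 / c ^ 2 * exp (- (c / 2 * L)) * exp (c * R x))"
      using dom
    proof eventually_elim
      case (elim x)
      then have I0: "0 \<le> I x" and IR: "I x \<le> R x" by auto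
      have nI: "norm (z * of_real (I x)) = norm z * I x" using I0 by (simp add: norm_mult)
      have "norm (t x) \<le> (norm z * I x) ^ 2 * exp (norm z * I x)"
        using norm_exp_Taylor1[of "z * of_real (I x)"] by (simp add: t_def nI)
      also have "\<dots> = norm z ^ 2 * (I x ^ 2 * exp (norm z * I x))"
        by (simp add: power_mult_distrib)
      also have "\<dots> \<le> norm z ^ 2 * (L * exp (norm z * L) * I x
               + 32 / c ^ 2 * exp (- (c / 2 * L)) * exp (c * R x))"
      proof (rule mult_left_mono)
        show "I x ^ 2 * exp (norm z * I x) \<le> L * exp (norm z * L) * I x
               + 32 / c ^ 2 * exp (- (c / 2 * L)) * exp (c * R x)"
        proof (cases "I x \<le> L")
          case True
          have "I x ^ 2 * exp (norm z * I x) \<le> (L * I x) * exp (norm z * L)"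
            unfolding power2_eq_square
            using True I0 L by (intro mult_mono) (auto intro!: mult_left_mono)
          also have "\<dots> \<le> L * exp (norm z * L) * I x
               + 32 / c ^ 2 * exp (- (c / 2 * L)) * exp (c * R x)"
            by (simp add: mult_ac)
          finally show ?thesis .
        next
          case False
          \<comment> \<open>Above \<open>L\<close>, one quarter of the exponent \<open>c\<close>
            covers \<open>exp (norm z * I x)\<close> and another the square, with constant
            \<open>32 = fact 2 * 4 ^ 2\<close>. The remaining half yields the decay in
            \<open>L\<close>, since \<open>L < I x\<close> and \<open>I x \<le> R x\<close>.\<close>
          have "norm z * I x \<le> c / 4 * I x" using z I0 by (rule mult_right_mono)
          then have "I x ^ 2 * exp (norm z * I x) \<le> (fact 2 / (c / 4) ^ 2 * exp (c / 4 * I x)) * exp (c / 4 * I x)"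
            using I0 c by (intro mult_mono power_le_exp) auto
          also have "\<dots> = 32 / c ^ 2 * exp (c / 2 * I x)"
            by (simp add: power2_eq_square flip: exp_add)
          also have "\<dots> \<le> 32 / c ^ 2 * exp (- (c / 2 * L) + c * R x)"
          proof (rule mult_left_mono)
            have "c / 2 * I x + c / 2 * L \<le> c / 2 * R x + c / 2 * R x"
              using False IR c by (intro add_mono mult_left_mono) auto
            then show "exp (c / 2 * I x) \<le> exp (- (c / 2 * L) + c * R x)" by simp
          qed simp
          also have "\<dots> \<le> L * exp (norm z * L) * I x
               + 32 / c ^ 2 * exp (- (c / 2 * L)) * exp (c * R x)"
            using I0 L unfolding exp_add by (simp add: mult.assoc)
          finally show ?thesis .
        qed
      qed simp
      finally show ?case .
    qed
  qed
  finally show ?thesis using R I1 by simp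
qed

end

section \<open>Approximate equation for the transform of the waiting time\<close>

context lindley_stationary
begin

text \<open>In the exact identity the increment's transform is expanded to second order and the
  idle-time transform to first order. The constants cancel and both linear terms are
  \<open>z * m\<close>. Dividing by \<open>z * m\<close> leaves the two remainders as
  \<open>e1\<close> and \<open>e2\<close>.\<close>

lemma transform_equation:
  fixes z :: complex and c \<theta> L :: real and R :: "'a \<Rightarrow> real"
  assumes [measurable]: "R \<in> borel_measurable M"
    and R: "AE x in M. \<bar>X x\<bar> \<le> R x" "integrable M (\<lambda>x. exp (c * R x))" and c: "0 < c"
    and m: "0 < m" "(\<integral>x. X x \<partial>M) = - m"
    and W: "integrable N (\<lambda>y. exp (\<theta> * W y))"
    and \<theta>: "0 < \<theta>" "- \<theta> \<le> Re z" and z: "norm z \<le> c / 4" and L: "0 \<le> L"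
  defines "E \<equiv> \<integral>x. exp (c * R x) \<partial>M" and "q \<equiv> \<integral>x. (X x)\<^sup>2 \<partial>M"
  shows "\<exists>e1 e2. (\<integral>y. exp (- z * complex_of_real (W y)) \<partial>N)
            * (1 + z * of_real (q / (2 * m)) + e1) = 1 + e2
          \<and> norm e1 \<le> norm z ^ 2 * (48 / c ^ 3 * E / m)
          \<and> norm e2 \<le> norm z * (L * exp (norm z * L) + 32 / c ^ 2 * exp (- (c / 2 * L)) * E / m)"
proof (cases "z = 0")
  case True
  then show ?thesis by (intro exI[of _ 0]) (simp add: N.prob_space)
next
  case False
  define f where "f = (\<integral>y. exp (- z * complex_of_real (W y)) \<partial>N)"
  define \<phi> where "\<phi> = (\<integral>x. exp (- z * complex_of_real (X x)) \<partial>M)"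
  define r3 where "r3 = \<phi> - (1 + (- z) * of_real (- m) + (- z) ^ 2 / 2 * of_real q)"
  have "norm (- z) \<le> c / 2" using z c by simp
  from M.mgf_Taylor2[OF X_meas R(1) c R(2) this]
  have r3: "norm r3 \<le> norm z ^ 3 * (48 / c ^ 3 * E)"
    by (simp add: r3_def \<phi>_def E_def q_def m)
  have X: "integrable M X"
    using M.integrable_power_exp_dominated[OF X_meas R(1) c R(2), of 1] by simp
  have eX: "integrable M (\<lambda>x. exp (- z * complex_of_real (X x)))"
    by (rule M.integrable_exp_dominated[OF X_meas R(1) c R(2)]) (use z c in simp)
  have eW: "integrable N (\<lambda>y. exp (- z * complex_of_real (W y)))"
    by (rule integrable_cexp_W[OF _ \<theta>(2) W]) (use \<theta> in simp)
  have W1: "integrable N W"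
  proof (rule Bochner_Integration.integrable_bound)
    show "integrable N (\<lambda>y. 1 / \<theta> * exp (\<theta> * W y))" using W by simp
    show "AE y in N. norm (W y) \<le> norm (1 / \<theta> * exp (\<theta> * W y))"
      using W_nonneg
    proof eventually_elim
      case (elim y)
      then show ?case using power_le_exp[of "W y" \<theta> 1] \<theta> by simp
    qed
  qed simp
  \<comment> \<open>Since \<open>W\<close> is nonnegative, the negative part of \<open>W + X\<close>
    is at most the absolute value of \<open>X\<close>, so \<open>R\<close> also dominates
    \<open>idle\<close>.\<close>
  have snd: "AE p in N \<Otimes>\<^sub>M M. 0 \<le> W (fst p) \<and> \<bar>X (snd p)\<bar> \<le> R (snd p)"
  proof (rule NM.AE_pair_measure)
    show "AE y in N. AE x in M. 0 \<le> W (fst (y, x)) \<and> \<bar>X (snd (y, x))\<bar> \<le> R (snd (y, x))"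
      using W_nonneg
    proof eventually_elim
      case (elim y)
      from R(1) show ?case by eventually_elim (use elim in auto)
    qed
  qed measurable
  have dom: "AE p in N \<Otimes>\<^sub>M M. 0 \<le> idle p \<and> idle p \<le> R (snd p)"
    using snd by eventually_elim (auto simp: idle_def case_prod_unfold)
  have R2: "integrable (N \<Otimes>\<^sub>M M) (\<lambda>p. exp (c * R (snd p)))"
      "(\<integral>p. exp (c * R (snd p)) \<partial>(N \<Otimes>\<^sub>M M)) = E"
    using NM.integrable_times[of "\<lambda>_. 1" "\<lambda>x. exp (c * R x)"] R(2)
      NM.integral_times[of "\<lambda>_. 1" "\<lambda>x. exp (c * R x)"]
    by (simp_all add: case_prod_unfold N.prob_space E_def)
  define g where "g = (\<integral>p. exp (z * complex_of_real (idle p)) \<partial>(N \<Otimes>\<^sub>M M))"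
  define r2 where "r2 = g - (1 + z * of_real m)"
  have r2: "norm r2 \<le> norm z ^ 2 * (L * exp (norm z * L) * m + 32 / c ^ 2 * exp (- (c / 2 * L)) * E)"
    using NM.P.mgf_Taylor1_split[OF idle_meas dom c R2(1) z L]
    by (simp add: r2_def g_def mean_idle[OF W1 X] m R2)
  have ig: "integrable (N \<Otimes>\<^sub>M M) (\<lambda>p. exp (z * complex_of_real (idle p)))"
    by (rule NM.P.integrable_exp_dominated[OF idle_meas _ c R2(1)])
      (use dom z c in auto)
  have "f * (1 - \<phi>) = 1 - g"
    using waiting_idle_transform[OF eW eX] ig
    by (simp add: f_def \<phi>_def g_def NM.P.prob_space)
  then have *: "f * (z * m + z ^ 2 * q / 2 + r3) = z * m + r2"
    by (simp add: r2_def r3_def algebra_simps)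
  have zm: "z * of_real m \<noteq> 0" using False m by simp
  show ?thesis
    unfolding f_def[symmetric]
  proof (intro exI conjI)
    have "f * (1 + z * of_real (q / (2 * m)) + r3 / (z * m)) = f * (z * m + z ^ 2 * q / 2 + r3) / (z * m)"
      using zm m False by (simp add: field_simps power2_eq_square)
    also have "\<dots> = 1 + r2 / (z * m)"
      using zm unfolding * by (simp add: field_simps)
    finally show "f * (1 + z * of_real (q / (2 * m)) + r3 / (z * m)) = 1 + r2 / (z * m)" .
    have nz: "0 < norm z" using False by simp
    show "norm (r3 / (z * m)) \<le> norm z ^ 2 * (48 / c ^ 3 * E / m)"
    proof -
      have "norm (r3 / (z * m)) \<le> norm z ^ 3 * (48 / c ^ 3 * E) / (norm z * m)"
        unfolding norm_divide norm_mult norm_of_real abs_of_pos[OF m(1)]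
        using r3 nz m by (intro divide_right_mono) auto
      also have "\<dots> = norm z ^ 2 * (48 / c ^ 3 * E / m)"
        using nz m by (simp add: power2_eq_square power3_eq_cube)
      finally show ?thesis .
    qed
    show "norm (r2 / (z * m)) \<le> norm z * (L * exp (norm z * L) + 32 / c ^ 2 * exp (- (c / 2 * L)) * E / m)"
    proof -
      have "norm (r2 / (z * m))
          \<le> norm z ^ 2 * (L * exp (norm z * L) * m + 32 / c ^ 2 * exp (- (c / 2 * L)) * E) / (norm z * m)"
        unfolding norm_divide norm_mult norm_of_real abs_of_pos[OF m(1)]
        using r2 nz m by (intro divide_right_mono) auto
      also have "\<dots> = norm z * (L * exp (norm z * L) + 32 / c ^ 2 * exp (- (c / 2 * L)) * E / m)"
        using nz m by (simp add: power2_eq_square field_simps)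
      finally show ?thesis .
    qed
  qed
qed

end

section \<open>Heavy traffic\<close>

text \<open>Independence identifies the product of the laws of \<open>V\<close> and \<open>T\<close>
  with their joint law on \<open>M\<close>. The threefold product is therefore the image of the
  product of \<open>N\<close> and \<open>M\<close>.\<close>

lemma lindley_stationaryI:
  assumes M: "prob_space M" and ind: "prob_space.indep_var M borel V borel T"
    and st: "steady_state_waiting_time N W M V T"
  shows "lindley_stationary N M W (\<lambda>x. V x - T x)"
proof -
  interpret M: prob_space M by fact
  interpret N: prob_space N using st by (simp add: steady_state_waiting_time_def)
  have [measurable]: "W \<in> borel_measurable N"
    using st by (simp add: steady_state_waiting_time_def)
  have [measurable]: "V \<in> borel_measurable M" "T \<in> borel_measurable M"
    and joint: "distr M borel V \<Otimes>\<^sub>M distr M borel T = distr M (borel \<Otimes>\<^sub>M borel) (\<lambda>x. (V x, T x))"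
    using ind by (auto simp: M.indep_var_distribution_eq)
  interpret VT: prob_space "distr M (borel \<Otimes>\<^sub>M borel) (\<lambda>x. (V x, T x))"
    by (rule M.prob_space_distr) measurable
  have "distr N borel W \<Otimes>\<^sub>M (distr M borel V \<Otimes>\<^sub>M distr M borel T)
      = distr (N \<Otimes>\<^sub>M M) (borel \<Otimes>\<^sub>M (borel \<Otimes>\<^sub>M borel)) (\<lambda>(y, x). (W y, (V x, T x)))"
    unfolding joint by (rule pair_measure_distr) (measurable, unfold_locales)
  then have "distr N borel W = distr (distr (N \<Otimes>\<^sub>M M) (borel \<Otimes>\<^sub>M (borel \<Otimes>\<^sub>M borel))
      (\<lambda>(y, x). (W y, (V x, T x)))) borel (\<lambda>(w, v, t). max 0 (w + v - t))"
    using st by (simp add: steady_state_waiting_time_def)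
  also have "\<dots> = distr (N \<Otimes>\<^sub>M M) borel (\<lambda>(y, x). max 0 (W y + (V x - T x)))"
    by (subst distr_distr) (auto simp: comp_def case_prod_unfold algebra_simps)
  finally have eq: "distr N borel W = distr (N \<Otimes>\<^sub>M M) borel (\<lambda>(y, x). max 0 (W y + (V x - T x)))" .
  show ?thesis
    by unfold_locales (use st eq in \<open>auto simp: steady_state_waiting_time_def\<close>)
qed

text \<open>The difference equals \<open>e2 / (D + e1) - e1 / (D * (D + e1))\<close>, where
  \<open>D + e1\<close> has modulus at least 1/2. This gives the factors 2 and 8/3, the latter
  rounded up to 3.\<close>

lemma perturbed_inverse:
  fixes f D e1 e2 :: complex
  assumes eq: "f * (D + e1) = 1 + e2" and D: "3 / 4 \<le> norm D" and e1: "norm e1 \<le> 1 / 4"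
  shows "norm (f - inverse D) \<le> 2 * norm e2 + 3 * norm e1"
proof -
  have "norm D - norm e1 \<le> norm (D + e1)" using norm_triangle_ineq2[of D "- e1"] by simp
  then have De: "1 / 2 \<le> norm (D + e1)" using D e1 by simp
  then have nz: "D + e1 \<noteq> 0" "D \<noteq> 0" using D by auto
  have "f - inverse D = e2 / (D + e1) - e1 / (D * (D + e1))"
  proof -
    have "f = (1 + e2) / (D + e1)" using eq nz by (simp add: field_simps)
    then show ?thesis using nz by (simp add: divide_simps) (simp add: algebra_simps)
  qed
  also have "norm \<dots> \<le> norm (e2 / (D + e1)) + norm (e1 / (D * (D + e1)))"
    by (rule norm_triangle_ineq4)
  also have "\<dots> \<le> norm e2 / (1 / 2) + norm e1 / (3 / 4 * (1 / 2))"
    unfolding norm_divide norm_mult using D De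
    by (intro add_mono divide_left_mono mult_mono) (auto intro!: mult_pos_pos)
  also have "\<dots> \<le> 2 * norm e2 + 3 * norm e1" by simp
  finally show ?thesis .
qed

text \<open>For \<alpha> at most 1/2 the factor \<open>1 / (1 - \<alpha>)\<close> is at most 2, so
  \<open>V + 2 * U\<close> dominates every increment. The one moment \<open>exp_int\<close> thus
  makes all estimates uniform in \<alpha>.\<close>

locale heavy_traffic = prob_space M for M :: "'a measure" +
  fixes V U :: "'a \<Rightarrow> real" and c :: real
  assumes indep: "indep_var borel V borel U"
    and V_nonneg: "AE x in M. 0 \<le> V x" and U_nonneg: "AE x in M. 0 \<le> U x"
    and V_int: "integrable M V" and U_int: "integrable M U"
    and mean_V: "expectation V = 1" and mean_U: "expectation U = 1"
    and V_sq: "integrable M (\<lambda>x. (V x)\<^sup>2)" and U_sq: "integrable M (\<lambda>x. (U x)\<^sup>2)"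
    and var_pos: "0 < variance V + variance U"
    and c_pos: "0 < c" and exp_int: "integrable M (\<lambda>x. exp (c * (V x + 2 * U x)))"
begin

lemma [measurable]: "V \<in> borel_measurable M" "U \<in> borel_measurable M"
  using V_int U_int by auto

section \<open>Moments and uniform bounds for the increment\<close>

definition X :: "real \<Rightarrow> 'a \<Rightarrow> real" where "X \<alpha> x = V x - 1 / (1 - \<alpha>) * U x"

lemma X_meas [measurable]: "X \<alpha> \<in> borel_measurable M"
  unfolding X_def by measurable

lemma X_dominated:
  assumes "0 < \<alpha>" "\<alpha> \<le> 1 / 2"
  shows "AE x in M. \<bar>X \<alpha> x\<bar> \<le> V x + 2 * U x"
  using V_nonneg U_nonneg
proof eventually_elim
  case (elim x)
  have "1 / (1 - \<alpha>) * U x \<le> 2 * U x"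
    using assms elim by (intro mult_right_mono) (auto simp: field_simps)
  moreover have "0 \<le> 1 / (1 - \<alpha>) * U x" using assms elim by simp
  ultimately show ?case unfolding X_def using elim by linarith
qed

lemma mean_X: "\<alpha> < 1 \<Longrightarrow> expectation (X \<alpha>) = - (\<alpha> / (1 - \<alpha>))"
  unfolding X_def using V_int U_int by (simp add: mean_V mean_U field_simps)

text \<open>The two summands are the variance of the increment and the square of its mean.\<close>

lemma second_moment_X:
  assumes "\<alpha> < 1"
  shows "expectation (\<lambda>x. (X \<alpha> x)\<^sup>2) =
    heavy_traffic_variance M V U \<alpha> / (1 - \<alpha>) + \<alpha>\<^sup>2 / (1 - \<alpha>)\<^sup>2"
proof -
  define r where "r = 1 - \<alpha>"
  have r: "0 < r" "\<alpha> = 1 - r" using assms by (auto simp: r_def)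
  have VU: "integrable M (\<lambda>x. V x * U x)" "expectation (\<lambda>x. V x * U x) = 1"
    using indep_var_integrable[OF indep V_int U_int]
      indep_var_lebesgue_integral[OF indep V_int U_int] by (simp_all add: mean_V mean_U)
  have vV: "variance V = expectation (\<lambda>x. (V x)\<^sup>2) - 1"
    using variance_eq[OF V_int V_sq] by (simp add: mean_V)
  have vU: "variance U = expectation (\<lambda>x. (U x)\<^sup>2) - 1"
    using variance_eq[OF U_int U_sq] by (simp add: mean_U)
  have "(X \<alpha> x)\<^sup>2 = (V x)\<^sup>2 - 2 / r * (V x * U x) + (U x)\<^sup>2 / r\<^sup>2" for x
    by (simp add: X_def r_def power2_eq_square algebra_simps)
  then have "expectation (\<lambda>x. (X \<alpha> x)\<^sup>2)
      = expectation (\<lambda>x. (V x)\<^sup>2) - 2 / r + expectation (\<lambda>x. (U x)\<^sup>2) / r\<^sup>2"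
    using V_sq U_sq VU by simp
  also have "\<dots> = heavy_traffic_variance M V U \<alpha> / r + \<alpha>\<^sup>2 / r\<^sup>2"
    using r(1) unfolding heavy_traffic_variance_def Let_def r_def[symmetric] vV vU r(2)
    by (simp add: field_simps power2_eq_square)
  finally show ?thesis by (simp add: r_def)
qed

text \<open>A lower bound free of \<alpha>, so that \<open>\<alpha> / (2 * h)\<close> is at most
  \<alpha> divided by a fixed positive constant.\<close>

lemma heavy_traffic_variance_ge:
  assumes "0 < \<alpha>" "\<alpha> \<le> 1 / 2"
  shows "(variance V + variance U) / 2 \<le> heavy_traffic_variance M V U \<alpha>"
proof -
  have v: "0 \<le> variance V" "0 \<le> variance U" by (rule variance_positive)+
  have "(1 / 2) * variance V \<le> (1 - \<alpha>) * variance V"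
    using assms v by (intro mult_right_mono) auto
  moreover have "variance U / 2 \<le> variance U / (1 - \<alpha>)"
    using assms v by (intro divide_left_mono) auto
  moreover have "heavy_traffic_variance M V U \<alpha> = (1 - \<alpha>) * variance V + variance U / (1 - \<alpha>)"
    using assms by (simp add: heavy_traffic_variance_def field_simps power2_eq_square)
  ultimately show ?thesis by argo
qed

definition R :: "'a \<Rightarrow> real" where "R x = V x + 2 * U x"

definition E :: real where "E = expectation (\<lambda>x. exp (c * R x))"

lemma R_meas [measurable]: "R \<in> borel_measurable M"
  unfolding R_def by measurable

lemma R_int: "integrable M (\<lambda>x. exp (c * R x))"
  using exp_int by (simp add: R_def)

lemma E_nonneg: "0 \<le> E" by (simp add: E_def)

text \<open>The choice of \<theta> matches the boundary \<open>Re s = - 1 / (2 * h)\<close> at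
  \<open>z = \<alpha> * s\<close>. To leading order it is a quarter of the nonzero root
  \<open>2 * \<alpha> / h\<close> of the equation that sets this moment equal to 1, so the negative
  drift wins.\<close>

lemma exp_moment_less_1:
  fixes \<alpha> :: real
  defines "v \<equiv> variance V + variance U" and "h \<equiv> heavy_traffic_variance M V U \<alpha>"
  defines "\<theta> \<equiv> \<alpha> / (2 * h)"
  assumes \<alpha>: "0 < \<alpha>" "\<alpha> \<le> 1 / 2" "\<alpha> \<le> v / 16" "\<alpha> * (48 / c ^ 3 * E) \<le> v\<^sup>2 / 4"
    and c: "\<alpha> \<le> c * v / 2"
  shows "integrable M (\<lambda>x. exp (\<theta> * X \<alpha> x))" and "expectation (\<lambda>x. exp (\<theta> * X \<alpha> x)) < 1"
proof -
  have v: "0 < v" using var_pos by (simp add: v_def)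
  have h1: "v / 2 \<le> h"
    using heavy_traffic_variance_ge[OF \<alpha>(1,2)] by (simp add: v_def h_def)
  with v have h: "v / 2 \<le> h" "0 < h" by linarith+
  have \<theta>0: "0 < \<theta>" using h \<alpha> by (simp add: \<theta>_def)
  have \<theta>v: "\<theta> \<le> \<alpha> / v"
    using h \<alpha> v unfolding \<theta>_def by (intro divide_left_mono) auto
  also have "\<dots> \<le> c / 2" using c v by (simp add: field_simps)
  finally have \<theta>c: "\<theta> \<le> c / 2" .
  have dom: "AE x in M. \<bar>X \<alpha> x\<bar> \<le> R x" using X_dominated[OF \<alpha>(1,2)] by (simp add: R_def)
  show "integrable M (\<lambda>x. exp (\<theta> * X \<alpha> x))"
    using integrable_exp_dominated[OF X_meas dom c_pos R_int, of \<theta>] \<theta>0 \<theta>c c_pos by simp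
  define m where "m = \<alpha> / (1 - \<alpha>)"
  define C where "C = 48 / c ^ 3 * E"
  define q where "q = expectation (\<lambda>x. (X \<alpha> x)\<^sup>2)"
  have m: "\<alpha> \<le> m" "m \<le> 2 * \<alpha>" using \<alpha> by (auto simp: m_def field_simps)
  have C: "0 \<le> C" using c_pos E_nonneg by (simp add: C_def)
  have "\<bar>expectation (\<lambda>x. exp (\<theta> * X \<alpha> x)) - (1 - \<theta> * m + \<theta>\<^sup>2 / 2 * q)\<bar> \<le> \<theta> ^ 3 * C"
    using mgf_Taylor2[OF X_meas dom c_pos R_int, of \<theta>] \<theta>0 \<theta>c \<alpha>
    by (simp add: mean_X C_def E_def q_def m_def)
  then have "expectation (\<lambda>x. exp (\<theta> * X \<alpha> x)) \<le> 1 - \<theta> * (m - \<theta> * q / 2 - \<theta>\<^sup>2 * C)"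
    by (simp add: algebra_simps power2_eq_square power3_eq_cube abs_le_iff)
  also have "\<dots> < 1"
  proof -
    \<comment> \<open>The gain is \<open>m\<close>. The quadratic term costs exactly
      \<open>m / 4\<close> plus a small correction; the correction and the cubic remainder each cost
      at most \<open>m / 4\<close>, so at least \<open>m / 4\<close> is left.\<close>
    have "\<theta> * q / 2 = m / 4 + m\<^sup>2 * (\<theta> / 2)"
    proof -
      have "q = h / (1 - \<alpha>) + m\<^sup>2"
        using \<alpha> by (simp add: q_def second_moment_X m_def h_def power_divide)
      moreover have "\<theta> * (h / (1 - \<alpha>)) = m / 2"
        using h by (simp add: \<theta>_def m_def)
      ultimately have "\<theta> * q = m / 2 + \<theta> * m\<^sup>2" by (simp only: distrib_left)
      then show ?thesis by (simp add: algebra_simps)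
    qed
    moreover have "m\<^sup>2 * (\<theta> / 2) \<le> m / 4"
    proof -
      have "m * \<theta> \<le> (2 * \<alpha>) * (\<alpha> / v)" using m \<theta>v \<theta>0 \<alpha> by (intro mult_mono) auto
      also have "\<dots> \<le> 1 * (1 / 2)"
      proof (intro mult_mono)
        show "\<alpha> / v \<le> 1 / 2" using \<alpha> v by (simp add: field_simps)
      qed (use \<alpha> v in auto)
      finally have "m * (m * \<theta>) \<le> m * (1 / 2)" using m \<alpha> by (intro mult_left_mono) auto
      then show ?thesis by (simp add: power2_eq_square mult_ac)
    qed
    moreover have "\<theta>\<^sup>2 * C \<le> m / 4"
    proof -
      have "\<theta>\<^sup>2 * C \<le> (\<alpha> / v)\<^sup>2 * C"
        using \<theta>v \<theta>0 C by (intro mult_right_mono power_mono) auto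
      also have "\<dots> = \<alpha> * (\<alpha> * C) / v\<^sup>2" by (simp add: power2_eq_square)
      also have "\<dots> \<le> \<alpha> * (v\<^sup>2 / 4) / v\<^sup>2"
        using \<alpha> unfolding C_def by (intro divide_right_mono mult_left_mono) auto
      also have "\<dots> = \<alpha> / 4" using v by simp
      finally show ?thesis using m by simp
    qed
    ultimately have "0 < m - \<theta> * q / 2 - \<theta>\<^sup>2 * C" using m \<alpha> by linarith
    then show ?thesis using \<theta>0 by simp
  qed
  finally show "expectation (\<lambda>x. exp (\<theta> * X \<alpha> x)) < 1" .
qed

text \<open>Apply \<open>transform_equation\<close> at \<open>z = \<alpha> * s\<close> with a
  logarithmic cutoff, then \<open>perturbed_inverse\<close> with \<open>D = 1 + h * s / 2\<close>.
  The constant involves only \<open>B\<close>, \<open>c\<close> and \<open>E\<close>, which is the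
  claimed uniformity in \<alpha> and \<open>s\<close>.\<close>

lemma transform_error:
  fixes \<alpha> B :: real and s :: complex
  defines "v \<equiv> variance V + variance U" and "h \<equiv> heavy_traffic_variance M V U \<alpha>"
    and "C \<equiv> 48 / c ^ 3 * E"
  assumes st: "lindley_stationary N M W (X \<alpha>)"
    and \<alpha>: "0 < \<alpha>" "\<alpha> \<le> 1 / 2" "\<alpha> \<le> exp (- 1)" "\<alpha> \<le> v / 16" "\<alpha> * C \<le> v\<^sup>2 / 4"
      "\<alpha> \<le> c * v / 2"
    and B: "norm s \<le> B" "\<alpha> * B \<le> c / 4" "\<alpha> * (B + B\<^sup>2 * C) \<le> 1 / 4"
    and s: "- 1 / (2 * h) \<le> Re s"
  shows "integrable N (\<lambda>y. exp (- complex_of_real \<alpha> * s * complex_of_real (W y)))"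
    and "norm ((\<integral>y. exp (- complex_of_real \<alpha> * s * complex_of_real (W y)) \<partial>N)
            - inverse (1 + complex_of_real h * s / 2))
         \<le> (2 * B * (2 / c * exp (2 * B / c) + 32 / c\<^sup>2 * E) + 3 * (B + B\<^sup>2 * C)) * \<alpha> * ln (1 / \<alpha>)"
proof -
  interpret L: lindley_stationary N M W "X \<alpha>" by fact
  have v: "0 < v" using var_pos by (simp add: v_def)
  have h1: "v / 2 \<le> h"
    using heavy_traffic_variance_ge[OF \<alpha>(1,2)] by (simp add: v_def h_def)
  with v have h: "v / 2 \<le> h" "0 < h" by linarith+
  have C: "0 \<le> C" using c_pos E_nonneg by (simp add: C_def)
  have B0: "0 \<le> B" using B(1) norm_ge_zero[of s] by linarith
  define \<theta> where "\<theta> = \<alpha> / (2 * h)"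
  have \<theta>0: "0 < \<theta>" using h \<alpha> by (simp add: \<theta>_def)
  have eW: "integrable N (\<lambda>y. exp (\<theta> * W y))"
    unfolding \<theta>_def h_def
    by (rule L.integrable_exp_W; (rule exp_moment_less_1)?)
      (use \<theta>0 \<alpha> in \<open>simp_all add: \<theta>_def h_def v_def C_def\<close>)
  define z where "z = complex_of_real \<alpha> * s"
  have "- \<theta> = \<alpha> * (- 1 / (2 * h))" by (simp add: \<theta>_def)
  also have "\<dots> \<le> \<alpha> * Re s" using s \<alpha> by (intro mult_left_mono) auto
  finally have \<theta>z: "- \<theta> \<le> Re z" by (simp add: z_def)
  show "integrable N (\<lambda>y. exp (- complex_of_real \<alpha> * s * complex_of_real (W y)))"
    using L.integrable_cexp_W[OF _ \<theta>z eW] \<theta>0 by (simp add: z_def)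
  have nz: "norm z \<le> \<alpha> * B" using B \<alpha> by (simp add: z_def norm_mult)
  then have zc: "norm z \<le> c / 4" using B by simp
  define l where "l = ln (1 / \<alpha>)"
  have l1: "1 \<le> l"
  proof -
    have "ln \<alpha> \<le> ln (exp (- 1))" using \<alpha> by (intro ln_mono) auto
    then show ?thesis using \<alpha> by (simp add: l_def ln_div)
  qed
  have al: "\<alpha> * l \<le> 1"
    using ln_le_minus_one[of "1 / \<alpha>"] \<alpha> by (simp add: l_def field_simps)
  \<comment> \<open>With this cutoff \<open>exp (- (c / 2 * L))\<close> equals \<alpha> and
    compensates the division by \<open>m\<close>, while \<open>norm z * L\<close> stays bounded
    because \<open>\<alpha> * l \<le> 1\<close>. Only the factor \<open>L\<close> itself contributes
    a logarithm.\<close>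
  define L where "L = 2 / c * l"
  have L0: "0 \<le> L" using l1 c_pos by (simp add: L_def)
  define m where "m = \<alpha> / (1 - \<alpha>)"
  define q where "q = expectation (\<lambda>x. (X \<alpha> x)\<^sup>2)"
  have m: "\<alpha> \<le> m" using \<alpha> by (auto simp: m_def field_simps)
  then have m0: "0 < m" using \<alpha> by simp
  have dom: "AE x in M. \<bar>X \<alpha> x\<bar> \<le> R x" using X_dominated[OF \<alpha>(1,2)] by (simp add: R_def)
  have mX: "expectation (X \<alpha>) = - m" using \<alpha> by (simp add: mean_X m_def)
  define f where "f = (\<integral>y. exp (- z * complex_of_real (W y)) \<partial>N)"
  obtain e1 e2 where eq: "f * (1 + z * of_real (q / (2 * m)) + e1) = 1 + e2"
    and e1: "norm e1 \<le> norm z ^ 2 * (48 / c ^ 3 * E / m)"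
    and e2: "norm e2 \<le> norm z * (L * exp (norm z * L) + 32 / c ^ 2 * exp (- (c / 2 * L)) * E / m)"
    using L.transform_equation[OF R_meas dom R_int c_pos m0 mX eW \<theta>0 \<theta>z zc L0]
    unfolding f_def q_def E_def by blast
  define D where "D = 1 + complex_of_real h * s / 2"
  \<comment> \<open>The squared mean in the second moment shifts the linear coefficient away from
    \<open>h / 2\<close>. This shift is of order \<alpha> and is treated as part of the
    perturbation.\<close>
  define d where "d = complex_of_real (m / 2) * z"
  have "z * of_real (q / (2 * m)) = complex_of_real (\<alpha> * q / (2 * m)) * s"
    by (simp add: z_def)
  also have "\<alpha> * q / (2 * m) = h / 2 + \<alpha> * m / 2"
  proof -
    have "q = h / (1 - \<alpha>) + m\<^sup>2"
      using \<alpha> by (simp add: q_def second_moment_X m_def h_def power_divide)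
    moreover have "\<alpha> * (h / (1 - \<alpha>)) = h * m" by (simp add: m_def)
    ultimately have "\<alpha> * q = h * m + \<alpha> * m\<^sup>2" by (simp only: distrib_left)
    then show ?thesis using m0 by (simp add: field_simps power2_eq_square)
  qed
  finally have Dd: "1 + z * of_real (q / (2 * m)) = D + d"
    by (simp add: D_def d_def z_def algebra_simps)
  have eq': "f * (D + (d + e1)) = 1 + e2"
    using eq unfolding Dd by (simp only: add.assoc)
  have "norm e1 \<le> (\<alpha> * B)\<^sup>2 * (C / \<alpha>)"
    using e1
  proof (rule order_trans)
    show "norm z ^ 2 * (48 / c ^ 3 * E / m) \<le> (\<alpha> * B)\<^sup>2 * (C / \<alpha>)"
      unfolding C_def[symmetric] using nz m m0 C \<alpha>
      by (intro mult_mono power_mono divide_left_mono) auto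
  qed
  also have "\<dots> = \<alpha> * (B\<^sup>2 * C)" using \<alpha> by (simp add: power2_eq_square)
  finally have e1': "norm e1 \<le> \<alpha> * (B\<^sup>2 * C)" .
  have "norm d = m / 2 * norm z" using m0 by (simp add: d_def norm_mult)
  also have "\<dots> \<le> 1 * (\<alpha> * B)"
    using nz m0 \<alpha> by (intro mult_mono) (auto simp: m_def field_simps)
  finally have d: "norm d \<le> \<alpha> * B" by simp
  have de: "norm (d + e1) \<le> \<alpha> * (B + B\<^sup>2 * C)"
    using norm_triangle_ineq[of d e1] d e1' by (simp add: algebra_simps)
  \<comment> \<open>The half-plane condition gives \<open>h * Re s / 2 \<ge> - 1 / 4\<close>, which
    keeps \<open>D\<close> away from the pole of the limit.\<close>
  have "3 / 4 \<le> Re D"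
  proof -
    have "h * (- 1 / (2 * h)) \<le> h * Re s" using s h by (intro mult_left_mono) auto
    then show ?thesis using h by (simp add: D_def)
  qed
  then have D: "3 / 4 \<le> norm D" using complex_Re_le_cmod[of D] by linarith
  have e2': "norm e2 \<le> \<alpha> * B * ((2 / c * exp (2 * B / c) + 32 / c\<^sup>2 * E) * l)"
  proof (rule order_trans[OF e2], rule mult_mono[OF nz])
    have "norm z * L \<le> (\<alpha> * B) * L" using nz L0 by (rule mult_right_mono)
    also have "\<dots> = (2 * B / c) * (\<alpha> * l)" by (simp add: L_def)
    also have "\<dots> \<le> 2 * B / c * 1"
      using al B0 c_pos by (intro mult_left_mono) auto
    finally have 1: "L * exp (norm z * L) \<le> 2 / c * exp (2 * B / c) * l"
      using l1 c_pos by (simp add: L_def field_simps)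
    have "exp (- (c / 2 * L)) = \<alpha>"
      using c_pos \<alpha> by (simp add: L_def l_def ln_div)
    then have "32 / c ^ 2 * exp (- (c / 2 * L)) * E / m = (32 / c\<^sup>2 * E) * (\<alpha> / m)"
      by simp
    also have "\<dots> \<le> (32 / c\<^sup>2 * E) * l"
    proof (rule mult_left_mono)
      have "\<alpha> / m \<le> 1" using m m0 by simp
      then show "\<alpha> / m \<le> l" using l1 by simp
    qed (use E_nonneg in simp)
    finally show "L * exp (norm z * L) + 32 / c ^ 2 * exp (- (c / 2 * L)) * E / m
        \<le> (2 / c * exp (2 * B / c) + 32 / c\<^sup>2 * E) * l"
      using 1 by (simp only: distrib_right)
    show "0 \<le> L * exp (norm z * L) + 32 / c ^ 2 * exp (- (c / 2 * L)) * E / m"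
      using L0 E_nonneg m0 by simp
  qed (use \<alpha> B0 in simp)
  have "norm (f - inverse D) \<le> 2 * norm e2 + 3 * norm (d + e1)"
    by (rule perturbed_inverse[OF eq' D]) (use de B in simp)
  also have "\<dots> \<le> 2 * (\<alpha> * B * ((2 / c * exp (2 * B / c) + 32 / c\<^sup>2 * E) * l))
      + 3 * (\<alpha> * (B + B\<^sup>2 * C) * l)"
  proof -
    \<comment> \<open>Since \<open>l \<ge> 1\<close>, an error of order \<alpha> is absorbed into
      the order \<open>\<alpha> * l\<close>.\<close>
    have "\<alpha> * (B + B\<^sup>2 * C) * 1 \<le> \<alpha> * (B + B\<^sup>2 * C) * l"
      using l1 \<alpha> B0 C by (intro mult_left_mono) auto
    then show ?thesis using e2' de by linarith
  qed
  also have "\<dots> = (2 * B * (2 / c * exp (2 * B / c) + 32 / c\<^sup>2 * E) + 3 * (B + B\<^sup>2 * C)) * \<alpha> * l"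
    by (simp add: algebra_simps)
  finally show "norm ((\<integral>y. exp (- complex_of_real \<alpha> * s * complex_of_real (W y)) \<partial>N)
            - inverse (1 + complex_of_real h * s / 2))
         \<le> (2 * B * (2 / c * exp (2 * B / c) + 32 / c\<^sup>2 * E) + 3 * (B + B\<^sup>2 * C)) * \<alpha> * ln (1 / \<alpha>)"
    by (simp add: f_def z_def D_def l_def)
qed

end

section \<open>From the strip condition to the uniform estimate\<close>

lemma mgf_analytic_on_strip_exp_integrable:
  assumes "mgf_analytic_on_strip M X \<delta>" "\<bar>t\<bar> \<le> \<delta>"
  shows "integrable M (\<lambda>x. exp (t * X x))"
proof -
  have "integrable M (\<lambda>x. exp (complex_of_real t * complex_of_real (X x)))"
    using assms unfolding mgf_analytic_on_strip_def by force
  then have "integrable M (\<lambda>x. norm (exp (complex_of_real t * complex_of_real (X x))))"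
    by (rule integrable_norm)
  then show ?thesis by simp
qed

text \<open>A sum is at most twice the larger summand.\<close>

lemma integrable_exp_add:
  fixes X Y :: "'a \<Rightarrow> real"
  assumes "X \<in> borel_measurable M" "Y \<in> borel_measurable M"
    and "integrable M (\<lambda>x. exp (2 * X x))" "integrable M (\<lambda>x. exp (2 * Y x))"
  shows "integrable M (\<lambda>x. exp (X x + Y x))"
proof (rule Bochner_Integration.integrable_bound)
  show "integrable M (\<lambda>x. exp (2 * X x) + exp (2 * Y x))" using assms by simp
  have "exp (X x + Y x) \<le> exp (2 * X x) + exp (2 * Y x)" for x
  proof (cases "X x \<le> Y x")
    case True
    then have "exp (X x + Y x) \<le> exp (2 * Y x)" by simp
    then show ?thesis using exp_ge_zero[of "2 * X x"] by linarith
  next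
    case False
    then have "exp (X x + Y x) \<le> exp (2 * X x)" by simp
    then show ?thesis using exp_ge_zero[of "2 * Y x"] by linarith
  qed
  then show "AE x in M. norm (exp (X x + Y x)) \<le> norm (exp (2 * X x) + exp (2 * Y x))"
    by (simp add: abs_of_pos add_pos_pos)
qed (use assms in measurable)

theorem theorem1:
  fixes M :: "'a measure" and V U :: "'a \<Rightarrow> real"
    and N :: "real \<Rightarrow> 'b measure" and W :: "real \<Rightarrow> 'b \<Rightarrow> real"
  assumes "prob_space M"
    and "prob_space.indep_var M borel V borel U"
    and "AE x in M. 0 \<le> V x" and "AE x in M. 0 \<le> U x"
    and "integrable M V" and "prob_space.expectation M V = 1"
    and "integrable M U" and "prob_space.expectation M U = 1"
    and "integrable M (\<lambda>x. (V x)\<^sup>2)" and "integrable M (\<lambda>x. (U x)\<^sup>2)"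
    and "0 < prob_space.variance M V + prob_space.variance M U"
    and "\<exists>\<delta>>0. mgf_analytic_on_strip M V \<delta> \<and> mgf_analytic_on_strip M U \<delta>"
    and "\<And>\<alpha>. 0 < \<alpha> \<Longrightarrow> \<alpha> < 1 \<Longrightarrow>
           steady_state_waiting_time (N \<alpha>) (W \<alpha>) M V (\<lambda>x. (1 / (1 - \<alpha>)) * U x)"
  shows "\<forall>S::complex set. bounded S \<longrightarrow>
    (\<exists>K \<alpha>\<^sub>0::real. 0 < \<alpha>\<^sub>0 \<and> \<alpha>\<^sub>0 < 1 \<and>
      (\<forall>\<alpha> s. 0 < \<alpha> \<and> \<alpha> < \<alpha>\<^sub>0 \<and> s \<in> S \<and>
          Re s \<ge> - 1 / (2 * heavy_traffic_variance M V U \<alpha>) \<longrightarrow>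
        integrable (N \<alpha>) (\<lambda>y. exp (- complex_of_real \<alpha> * s * complex_of_real (W \<alpha> y))) \<and>
        cmod ((\<integral>y. exp (- complex_of_real \<alpha> * s * complex_of_real (W \<alpha> y)) \<partial>N \<alpha>)
              - inverse (1 + complex_of_real (heavy_traffic_variance M V U \<alpha>) * s / 2))
          \<le> K * \<alpha> * ln (1 / \<alpha>)))"
proof (intro allI impI)
  fix S :: "complex set"
  assume "bounded S"
  then obtain B where B0: "0 < B" and B: "\<And>s. s \<in> S \<Longrightarrow> norm s \<le> B"
    by (auto simp: bounded_pos)
  interpret prob_space M by fact
  obtain \<delta> where \<delta>: "0 < \<delta>" "mgf_analytic_on_strip M V \<delta>" "mgf_analytic_on_strip M U \<delta>"
    using assms(12) by blast
  \<comment> \<open>The largest exponent needed is \<open>2 * (2 * c)\<close> for \<open>U\<close>,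
    which is exactly \<delta>.\<close>
  define c where "c = \<delta> / 4"
  have "integrable M (\<lambda>x. exp (c * V x + 2 * c * U x))"
  proof (rule integrable_exp_add)
    show "integrable M (\<lambda>x. exp (2 * (c * V x)))"
      using mgf_analytic_on_strip_exp_integrable[OF \<delta>(2), of "2 * c"] \<delta>(1) by (simp add: c_def mult.assoc)
    show "integrable M (\<lambda>x. exp (2 * (2 * c * U x)))"
      using mgf_analytic_on_strip_exp_integrable[OF \<delta>(3), of "2 * (2 * c)"] \<delta>(1) by (simp add: c_def mult.assoc)
  qed (use assms(5,7) in auto)
  then have exp_int: "integrable M (\<lambda>x. exp (c * (V x + 2 * U x)))"
    by (simp add: algebra_simps)
  interpret heavy_traffic M V U c
    by unfold_locales (fact assms(2-11) exp_int | simp add: c_def \<delta>(1))+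
  define v where "v = variance V + variance U"
  have v: "0 < v" using var_pos by (simp add: v_def)
  define C where "C = 48 / c ^ 3 * E"
  have C: "0 \<le> C" using c_pos E_nonneg by (simp add: C_def)
  define D where "D = B + B\<^sup>2 * C"
  have D: "0 < D" using B0 C by (simp add: D_def add_pos_nonneg)
  \<comment> \<open>The entries are the smallness conditions of \<open>transform_error\<close>
    solved for \<alpha>. Dividing by \<open>C + 1\<close> avoids a zero denominator, as
    \<open>C\<close> is only known to be nonnegative.\<close>
  define \<alpha>0 where "\<alpha>0 = Min {1 / 2, exp (- 1), v / 16, v\<^sup>2 / 4 / (C + 1), c * v / 2, c / 4 / B, 1 / 4 / D}"
  define K where "K = 2 * B * (2 / c * exp (2 * B / c) + 32 / c\<^sup>2 * E) + 3 * D"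
  show "\<exists>K \<alpha>\<^sub>0::real. 0 < \<alpha>\<^sub>0 \<and> \<alpha>\<^sub>0 < 1 \<and>
      (\<forall>\<alpha> s. 0 < \<alpha> \<and> \<alpha> < \<alpha>\<^sub>0 \<and> s \<in> S \<and>
          Re s \<ge> - 1 / (2 * heavy_traffic_variance M V U \<alpha>) \<longrightarrow>
        integrable (N \<alpha>) (\<lambda>y. exp (- complex_of_real \<alpha> * s * complex_of_real (W \<alpha> y))) \<and>
        cmod ((\<integral>y. exp (- complex_of_real \<alpha> * s * complex_of_real (W \<alpha> y)) \<partial>N \<alpha>)
              - inverse (1 + complex_of_real (heavy_traffic_variance M V U \<alpha>) * s / 2))
          \<le> K * \<alpha> * ln (1 / \<alpha>))"
  proof (rule exI[of _ K], rule exI[of _ \<alpha>0], intro conjI allI impI; (elim conjE)?)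
    show "0 < \<alpha>0" using v C D c_pos B0 by (simp add: \<alpha>0_def)
    show "\<alpha>0 < 1" by (simp add: \<alpha>0_def)
    fix \<alpha> s
    assume \<alpha>: "0 < \<alpha>" "\<alpha> < \<alpha>0" and s: "s \<in> S" "Re s \<ge> - 1 / (2 * heavy_traffic_variance M V U \<alpha>)"
    have le: "\<alpha> \<le> 1 / 2" "\<alpha> \<le> exp (- 1)" "\<alpha> \<le> v / 16" "\<alpha> \<le> v\<^sup>2 / 4 / (C + 1)"
        "\<alpha> \<le> c * v / 2" "\<alpha> \<le> c / 4 / B" "\<alpha> \<le> 1 / 4 / D"
      by (rule order_trans[OF less_imp_le[OF \<alpha>(2)]], unfold \<alpha>0_def, rule Min_le,
          simp only: finite.intros, simp only: insert_iff simp_thms)+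
    have "\<alpha> * C \<le> \<alpha> * (C + 1)" using \<alpha> by simp
    also have "\<dots> \<le> v\<^sup>2 / 4" using le(4) C by (simp add: field_simps)
    finally have \<alpha>C: "\<alpha> * C \<le> v\<^sup>2 / 4" .
    have \<alpha>B: "\<alpha> * B \<le> c / 4" using le(6) B0 by (simp add: field_simps)
    have \<alpha>D: "\<alpha> * D \<le> 1 / 4" using le(7) D by (simp add: field_simps)
    have "\<alpha> < 1" using le by simp
    have ind: "indep_var borel V borel (\<lambda>x. 1 / (1 - \<alpha>) * U x)"
      using indep_var_compose[OF indep measurable_ident, of "\<lambda>u. 1 / (1 - \<alpha>) * u" borel]
      by (simp add: comp_def id_def)
    have "lindley_stationary (N \<alpha>) M (W \<alpha>) (X \<alpha>)"
      using lindley_stationaryI[OF assms(1) ind assms(13)] \<alpha> \<open>\<alpha> < 1\<close> by (simp add: X_def [abs_def])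
    note T = transform_error[OF this \<alpha>(1) le(1,2) le(3)[unfolded v_def] \<alpha>C[unfolded C_def v_def]
        le(5)[unfolded v_def] B[OF s(1)] \<alpha>B \<alpha>D[unfolded D_def C_def] s(2)]
    show "integrable (N \<alpha>) (\<lambda>y. exp (- complex_of_real \<alpha> * s * complex_of_real (W \<alpha> y)))"
      by (rule T(1))
    show "cmod ((\<integral>y. exp (- complex_of_real \<alpha> * s * complex_of_real (W \<alpha> y)) \<partial>N \<alpha>)
              - inverse (1 + complex_of_real (heavy_traffic_variance M V U \<alpha>) * s / 2))
          \<le> K * \<alpha> * ln (1 / \<alpha>)"
      using T(2) by (simp only: K_def D_def C_def)
  qed
qed

end
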